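(* Let $B$ be a real Banach space and let $C$ be a nonempty subset of $B$. Then $\Pi_C$ is monotone in $B$ in the following sense: for any $x,y\in B$, any $jx\in J(x)$ and $jy\in J(y)$, $$\langle jx-jy,u-v\rangle\ge 0\quad\text{for any } u\in\pi_C(jx)\subset\Pi_C(x)\text{ and } v\in\pi_C(jy)\subset\Pi_C(y).$$
   Context: $B^*$ is the dual of $B$ and $\langle\cdot,\cdot\rangle$ is the pairing between $B^*$ and $B$. The normalized duality map is $J(x)=\{\psi\in B^*:\langle\psi,x\rangle=\|\psi\|\|x\|=\|x\|^2=\|\psi\|^2\}$ for $x\in B$. $V(\phi,x)=\|\phi\|^2-2\langle\phi,x\rangle+\|x\|^2$ for $\phi\in B^*$, $x\in B$. The generalized projection is $\pi_C(\phi)=\{u\in C: V(\phi,u)=\inf_{y\in C}V(\phi,y)\}$ for $\phi\in B^*$ (possibly empty), and the generalized metric projection $\Pi_C:B\to 2^C$ is $\Pi_C(x)=\bigcup_{jx\in J(x)}\pi_C(jx)$. *)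

theory Defs
  imports "HOL-Analysis.Analysis"
begin

(* The dual of a real Banach space 'a is the space 'a \<Rightarrow>\<^sub>L real of bounded linear functionals
   with the operator norm; the pairing of \<phi> with x is blinfun_apply \<phi> x. *)

definition duality_map :: "'a::banach \<Rightarrow> ('a \<Rightarrow>\<^sub>L real) set" where
  "duality_map x =
     {\<psi>. blinfun_apply \<psi> x = norm \<psi> * norm x \<and>
          norm \<psi> * norm x = (norm x)^2 \<and>
          (norm x)^2 = (norm \<psi>)^2}"

definition lyapunov_V :: "('a::banach \<Rightarrow>\<^sub>L real) \<Rightarrow> 'a \<Rightarrow> real" where
  "lyapunov_V \<phi> x = (norm \<phi>)^2 - 2 * blinfun_apply \<phi> x + (norm x)^2"

(* lyapunov_V \<phi> y \<ge> (norm \<phi> - norm y)^2 \<ge> 0, so for nonempty C the real-valued INF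
   is a genuine infimum. *)
definition generalized_proj :: "'a::banach set \<Rightarrow> ('a \<Rightarrow>\<^sub>L real) \<Rightarrow> 'a set" where
  "generalized_proj C \<phi> = {u \<in> C. lyapunov_V \<phi> u = (INF y\<in>C. lyapunov_V \<phi> y)}"

definition generalized_metric_proj :: "'a::banach set \<Rightarrow> 'a \<Rightarrow> 'a set" where
  "generalized_metric_proj C x = (\<Union>jx\<in>duality_map x. generalized_proj C jx)"

end

(* A generalized projection minimizes V(phi, -) over C. Adding V(jx,u) <= V(jx,v) and
   V(jy,v) <= V(jy,u), all squared norms cancel and 2 <jx - jy, u - v> >= 0 remains. *)
theory Submission
  imports Defs
begin

text \<open>\<open>lyapunov_V\<close> is a function of the functional plus a function of the point
  minus twice their pairing. Each of \<open>u\<close>, \<open>v\<close> competes against the other's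
  minimality over the same \<open>C\<close> (\<open>generalized_proj_le\<close>); in the sum of the
  two inequalities only the pairings survive (\<open>generalized_proj_monotone\<close>).\<close>

lemma lyapunov_V_nonneg: "lyapunov_V \<phi> x \<ge> 0"
proof -
  have "blinfun_apply \<phi> x \<le> norm \<phi> * norm x"
    using norm_blinfun[of \<phi> x] by simp
  moreover have "(norm \<phi> - norm x)^2 \<ge> 0"
    by simp
  ultimately show ?thesis
    \<comment> \<open>\<open>lyapunov_V \<phi> x\<close> exceeds the square above by
      \<open>2 * (norm \<phi> * norm x - blinfun_apply \<phi> x)\<close>.\<close>
    unfolding lyapunov_V_def power2_diff by linarith
qed

lemma generalized_proj_le:
  assumes "u \<in> generalized_proj C \<phi>" and "y \<in> C"
  shows "lyapunov_V \<phi> u \<le> lyapunov_V \<phi> y"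
proof -
  \<comment> \<open>A real \<open>INF\<close> is a genuine lower bound only when the set of values
    is bounded below.\<close>
  have "bdd_below (lyapunov_V \<phi> ` C)"
    by (rule bdd_belowI2[where m = 0]) (rule lyapunov_V_nonneg)
  then have "(INF y\<in>C. lyapunov_V \<phi> y) \<le> lyapunov_V \<phi> y"
    using \<open>y \<in> C\<close> by (rule cINF_lower)
  then show ?thesis
    using assms(1) by (simp add: generalized_proj_def)
qed

lemma generalized_proj_monotone:
  assumes u: "u \<in> generalized_proj C \<phi>" and v: "v \<in> generalized_proj C \<psi>"
  shows "blinfun_apply (\<phi> - \<psi>) (u - v) \<ge> 0"
proof -
  have "u \<in> C" "v \<in> C"
    using u v by (auto simp: generalized_proj_def)
  then have "lyapunov_V \<phi> u \<le> lyapunov_V \<phi> v" "lyapunov_V \<psi> v \<le> lyapunov_V \<psi> u"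
    using u v by (auto intro: generalized_proj_le)
  \<comment> \<open>In the sum of the two inequalities the squared norms cancel; by bilinearity,
    twice the claim remains.\<close>
  then show ?thesis
    by (simp add: lyapunov_V_def blinfun.diff_left blinfun.diff_right)
qed

theorem proposition3p9:
  fixes C :: "'a::banach set"
  assumes "C \<noteq> {}"
  shows "\<forall>x y. \<forall>jx\<in>duality_map x. \<forall>jy\<in>duality_map y.
           generalized_proj C jx \<subseteq> generalized_metric_proj C x \<and>
           generalized_proj C jy \<subseteq> generalized_metric_proj C y \<and>
           (\<forall>u\<in>generalized_proj C jx. \<forall>v\<in>generalized_proj C jy.
              blinfun_apply (jx - jy) (u - v) \<ge> 0)"
proof (intro allI ballI conjI)
  fix x y :: 'a and jx jy
  assume "jx \<in> duality_map x" "jy \<in> duality_map y"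
  then show "generalized_proj C jx \<subseteq> generalized_metric_proj C x"
    and "generalized_proj C jy \<subseteq> generalized_metric_proj C y"
    by (auto simp: generalized_metric_proj_def)
\<comment> \<open>The goal left is the inequality, with \<open>jx\<close> and \<open>jy\<close> as
  the two functionals.\<close>
qed (rule generalized_proj_monotone)

end
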